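(* Let $0<q<1$, $0<\alpha<q^{-1}$, $\beta<q^{-1}$ ($\alpha,\beta$ real). The monic little $q$-Jacobi polynomials $\tilde p_n(x;\alpha,\beta;q)$ satisfy, for all $n\in\mathbb{N}$, the three-term recurrence relation $$x\,\tilde p_n(x;\alpha,\beta;q)=\tilde p_{n+1}(x;\alpha,\beta;q)+b_n\,\tilde p_n(x;\alpha,\beta;q)+c_n\,\tilde p_{n-1}(x;\alpha,\beta;q),$$ $$b_n=\frac{q^n\left((1+\alpha)-\alpha(1+\beta)(1+q)q^n+\alpha\beta q(1+\alpha)q^{2n}\right)}{(1-\alpha\beta q^{2n})(1-\alpha\beta q^{2n+2})},$$ $$c_n=\alpha q^{2n-1}\frac{(1-q^n)(1-\alpha q^n)(1-\beta q^n)(1-\alpha\beta q^n)}{(1-\alpha\beta q^{2n-1})(1-\alpha\beta q^{2n})^2(1-\alpha\beta q^{2n+1})}.$$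
   Context: $\mathbb{N}=\{0,1,2,\dots\}$. The little $q$-Jacobi polynomials are $$p_n(x;\alpha,\beta;q)={}_2\varphi_1(q^{-n},\alpha\beta q^{n+1};\alpha q;q,qx)=\sum_{k=0}^n\frac{(q^{-n};q)_k(\alpha\beta q^{n+1};q)_k}{(q;q)_k(\alpha q;q)_k}(qx)^k,\qquad (x;q)_k=\prod_{j=0}^{k-1}(1-xq^j),$$ which have degree $n$; $\tilde p_n$ is $p_n$ divided by its leading coefficient. For $n=0$ the term $c_0\tilde p_{-1}$ is absent ($\tilde p_{-1}=0$). In the exceptional cases where a numerator and denominator factor vanish simultaneously ($\alpha\beta=1$, $n=0$ in $b_n$; $\alpha\beta q=1$, $n=1$ in $c_n$), the coefficients are understood by continuity in the parameters. *)

theory Defs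
  imports "HOL-Analysis.Analysis" "HOL-Computational_Algebra.Polynomial"
begin

definition q_pochhammer :: "real \<Rightarrow> real \<Rightarrow> nat \<Rightarrow> real" where
  "q_pochhammer x q k = (\<Prod>j<k. 1 - x * q ^ j)"

definition little_q_jacobi :: "nat \<Rightarrow> real \<Rightarrow> real \<Rightarrow> real \<Rightarrow> real poly" where
  "little_q_jacobi n \<alpha> \<beta> q =
     (\<Sum>k\<le>n. smult (q_pochhammer (q powi (- int n)) q k * q_pochhammer (\<alpha> * \<beta> * q ^ (n + 1)) q k
                     / (q_pochhammer q q k * q_pochhammer (\<alpha> * q) q k))
                  ([:0, q:] ^ k))"

definition monic_little_q_jacobi :: "nat \<Rightarrow> real \<Rightarrow> real \<Rightarrow> real \<Rightarrow> real poly" where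
  "monic_little_q_jacobi n \<alpha> \<beta> q =
     smult (1 / lead_coeff (little_q_jacobi n \<alpha> \<beta> q)) (little_q_jacobi n \<alpha> \<beta> q)"

text \<open>
  The quotient of \<open>f\<close> by \<open>g\<close> at the parameter pair \<open>z = (\<alpha>, \<beta>)\<close>, extended by
  continuity: where \<open>g\<close> vanishes, the value is the limit of \<open>f / g\<close> along the
  parameter pairs at which \<open>g\<close> does not vanish.
\<close>

definition quotient_by_continuity ::
    "(real \<times> real \<Rightarrow> real) \<Rightarrow> (real \<times> real \<Rightarrow> real) \<Rightarrow> real \<times> real \<Rightarrow> real" where
  "quotient_by_continuity f g z =
     (if g z \<noteq> 0 then f z / g z else Lim (at z within {w. g w \<noteq> 0}) (\<lambda>w. f w / g w))"

definition rec_b :: "nat \<Rightarrow> real \<Rightarrow> real \<Rightarrow> real \<Rightarrow> real" where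
  "rec_b n \<alpha> \<beta> q = quotient_by_continuity
     (\<lambda>(\<alpha>, \<beta>). q ^ n * ((1 + \<alpha>) - \<alpha> * (1 + \<beta>) * (1 + q) * q ^ n
                          + \<alpha> * \<beta> * q * (1 + \<alpha>) * q ^ (2 * n)))
     (\<lambda>(\<alpha>, \<beta>). (1 - \<alpha> * \<beta> * q ^ (2 * n)) * (1 - \<alpha> * \<beta> * q ^ (2 * n + 2)))
     (\<alpha>, \<beta>)"

text \<open>Meaningful only for \<open>n \<ge> 1\<close>, because of the truncated subtraction in \<open>2 * n - 1\<close>.\<close>

definition rec_c :: "nat \<Rightarrow> real \<Rightarrow> real \<Rightarrow> real \<Rightarrow> real" where
  "rec_c n \<alpha> \<beta> q = quotient_by_continuity
     (\<lambda>(\<alpha>, \<beta>). \<alpha> * q ^ (2 * n - 1)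
                 * ((1 - q ^ n) * (1 - \<alpha> * q ^ n) * (1 - \<beta> * q ^ n) * (1 - \<alpha> * \<beta> * q ^ n)))
     (\<lambda>(\<alpha>, \<beta>). (1 - \<alpha> * \<beta> * q ^ (2 * n - 1)) * (1 - \<alpha> * \<beta> * q ^ (2 * n))\<^sup>2
                 * (1 - \<alpha> * \<beta> * q ^ (2 * n + 1)))
     (\<alpha>, \<beta>)"

end

theory Submission
  imports Defs
begin

text \<open>
  Write \<open>t n k\<close> for the coefficient of \<open>x ^ k\<close> in the monic polynomial of degree \<open>n\<close>.  Comparing
  coefficients, the recurrence says \<open>t n (k - 1) = t (n + 1) k + b n * t n k + c n * t (n - 1) k\<close>.
  The coefficients are hypergeometric in \<open>n\<close> as well as in \<open>k\<close>: both \<open>t n k / t n (k + 1)\<close>, which is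
  read off from the \<open>q\<close>-shifted factorials, and \<open>t (n + 1) k / t n k\<close>, which follows from it by
  descending induction on \<open>k\<close> starting at the normalisation \<open>t n n = 1\<close>, are explicit rational
  functions of \<open>X = q ^ n\<close> and \<open>Y = q ^ k\<close> (\<open>monic_coeff_step\<close>, \<open>monic_coeff_degree_step\<close>).
  For \<open>k \<le> n\<close>, dividing the recurrence by \<open>t n k\<close> therefore leaves a single identity between rational functions of
  \<open>q\<close>, \<open>X\<close>, \<open>Y\<close>, \<open>\<alpha>\<close>, \<open>\<beta>\<close> (\<open>coefficient_identity\<close>), and clearing denominators turns it into a
  polynomial identity.

  The parameter conditions give \<open>\<alpha> * q < 1\<close> and \<open>\<alpha> * \<beta> * q\<^sup>2 < 1\<close>, so every factor
  \<open>1 - \<alpha> * \<beta> * q ^ j\<close> with \<open>j \<ge> 2\<close> is positive.  What remains delicate are the factors with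
  \<open>j \<le> 1\<close>.  Among the recurrence coefficients only \<open>b 0\<close> and \<open>c 1\<close> have them in the denominator, where
  they cancel against the numerator; the values by continuity are therefore those of the reduced fractions (\<open>rec_b_0\<close>,
  \<open>rec_c_1\<close>).  The same factor \<open>1 - \<alpha> * \<beta> * q\<close> would occur for \<open>n = 1\<close>, \<open>k = 0\<close> in the rational
  identity.  For this reason the case \<open>k = 0\<close> uses a version of the identity in which it has been
  cancelled (\<open>constant_coefficient_identity\<close>), and the case \<open>n = 0\<close> is computed directly.
\<close>

section \<open>Values by continuity\<close>

text \<open>
  Cancelling common factors gives a function \<open>h\<close> that agrees with \<open>f / g\<close> off the zeros of \<open>g\<close>; if it
  is continuous at \<open>z\<close>, it computes the value there.  The limit point condition is what makes
  the limit unique: without it the filter is trivial and \<open>Lim\<close> is an arbitrary value.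
\<close>

lemma quotient_by_continuity_eq:
  assumes "isCont h z" and eq: "\<And>w. g w \<noteq> 0 \<Longrightarrow> f w / g w = h w"
    and limpt: "g z = 0 \<Longrightarrow> z islimpt {w. g w \<noteq> 0}"
  shows "quotient_by_continuity f g z = h z"
proof (cases "g z = 0")
  case True
  let ?F = "at z within {w. g w \<noteq> 0}"
  have "\<not> trivial_limit ?F" using limpt[OF True] by (simp add: trivial_limit_within)
  moreover have "((\<lambda>w. f w / g w) \<longlongrightarrow> h z) ?F"
  proof (rule Lim_transform_eventually)
    show "(h \<longlongrightarrow> h z) ?F"
      using assms(1) unfolding isCont_def by (rule tendsto_within_subset) simp
    show "\<forall>\<^sub>F w in ?F. h w = f w / g w"
      unfolding eventually_at_filter using eq by (auto intro!: always_eventually)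
  qed
  ultimately have "Lim ?F (\<lambda>w. f w / g w) = h z" by (intro tendsto_Lim)
  then show ?thesis using True by (simp add: quotient_by_continuity_def)
qed (simp add: quotient_by_continuity_def eq)

text \<open>
  Used with \<open>S\<close> the parameters where a denominator does not vanish: as \<open>\<beta>\<close> is shrunk to \<open>t * \<beta>\<close>,
  a factor \<open>1 - \<alpha> * \<beta> * q ^ i\<close> that vanished becomes \<open>1 - t > 0\<close>.
\<close>

lemma islimpt_vertical_ray:
  fixes \<alpha> \<beta> :: real
  assumes "\<beta> \<noteq> 0" and "\<And>t. 0 < t \<Longrightarrow> t < 1 \<Longrightarrow> (\<alpha>, t * \<beta>) \<in> S"
  shows "(\<alpha>, \<beta>) islimpt S"
proof -
  define t :: "nat \<Rightarrow> real" where "t m = 1 - inverse (real (Suc (Suc m)))" for m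
  have t: "0 < t m" "t m < 1" for m by (auto simp: t_def field_simps)
  have "t \<longlonglongrightarrow> 1 - 0"
    unfolding t_def by (rule tendsto_diff[OF tendsto_const LIMSEQ_Suc[OF LIMSEQ_inverse_real_of_nat]])
  then have "(\<lambda>m. (\<alpha>, t m * \<beta>)) \<longlonglongrightarrow> (\<alpha>, (1 - 0) * \<beta>)"
    by (rule tendsto_Pair[OF tendsto_const tendsto_mult_right])
  then have "(\<lambda>m. (\<alpha>, t m * \<beta>)) \<longlonglongrightarrow> (\<alpha>, \<beta>)" by simp
  moreover have "(\<alpha>, t m * \<beta>) \<in> S - {(\<alpha>, \<beta>)}" for m
    using assms t[of m] by auto
  ultimately show ?thesis unfolding islimpt_sequential by (intro exI[of _ "\<lambda>m. (\<alpha>, t m * \<beta>)"]) simp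
qed

section \<open>The rational identities behind the recurrence\<close>

text \<open>
  The pattern of denominators shared by the two identities below.  Treating the denominators as
  opaque nonzero numbers keeps the clearing of fractions separate from the polynomial identity.
\<close>

lemma common_denominator:
  fixes A B C F e d1 d2 d3 d4 x :: real
  assumes "A * d2 * d3 * d4 = B * d1 * d2 + C * e * d1 * d3 + F * e * d4"
    and "e \<noteq> 0" "d1 \<noteq> 0" "d2 \<noteq> 0" "d3 \<noteq> 0" "d4 \<noteq> 0"
  shows "x * A / (e * d1) = x * B / (e * d3 * d4) + x * C / (d2 * d4) + x * F / (d1 * d2 * d3)"
proof -
  have "x * A / (e * d1) = x * (A * d2 * d3 * d4) / (e * d1 * d2 * d3 * d4)"
    using assms(2-) by simp
  also have "\<dots> = x * B / (e * d3 * d4) + x * C / (d2 * d4) + x * F / (d1 * d2 * d3)"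
    unfolding assms(1) using assms(2-) by (simp add: field_simps)
  finally show ?thesis .
qed

text \<open>
  Here \<open>X = q ^ n\<close> and \<open>Y = q ^ k\<close>; the four fractions are the terms of the recurrence for the
  coefficient of \<open>x ^ k\<close>, divided by that coefficient of the polynomial of degree \<open>n\<close>.
\<close>

lemma coefficient_identity:
  fixes q X Y \<alpha> \<beta> :: real
  assumes "X * q - Y \<noteq> 0" "1 - \<alpha> * \<beta> * X * Y \<noteq> 0" "1 - \<alpha> * \<beta> * X\<^sup>2 \<noteq> 0"
    "1 - \<alpha> * \<beta> * X\<^sup>2 * q \<noteq> 0" "1 - \<alpha> * \<beta> * X\<^sup>2 * q\<^sup>2 \<noteq> 0"
  shows "X * ((1 - Y) * (1 - \<alpha> * Y)) / ((X * q - Y) * (1 - \<alpha> * \<beta> * X * Y)) =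
     X * ((1 - X * q) * (1 - \<alpha> * X * q) * (1 - \<alpha> * \<beta> * X * Y * q))
       / ((X * q - Y) * (1 - \<alpha> * \<beta> * X\<^sup>2 * q) * (1 - \<alpha> * \<beta> * X\<^sup>2 * q\<^sup>2))
   + X * ((1 + \<alpha>) - \<alpha> * (1 + \<beta>) * (1 + q) * X + \<alpha> * \<beta> * q * (1 + \<alpha>) * X\<^sup>2)
       / ((1 - \<alpha> * \<beta> * X\<^sup>2) * (1 - \<alpha> * \<beta> * X\<^sup>2 * q\<^sup>2))
   + X * (\<alpha> * (1 - \<beta> * X) * (1 - \<alpha> * \<beta> * X) * (X - Y))
       / ((1 - \<alpha> * \<beta> * X * Y) * (1 - \<alpha> * \<beta> * X\<^sup>2) * (1 - \<alpha> * \<beta> * X\<^sup>2 * q))"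
  by (rule common_denominator; (fact assms)?; algebra)

text \<open>
  The case \<open>Y = 1\<close> with the common factor \<open>1 - \<alpha> * \<beta> * X\<close> cancelled from the last fraction, so that
  it stays valid when this factor vanishes, as it can for \<open>n = 1\<close>.
\<close>

lemma constant_coefficient_identity:
  fixes q X \<alpha> \<beta> :: real
  assumes "X * q - 1 \<noteq> 0" "1 - \<alpha> * \<beta> * X\<^sup>2 \<noteq> 0"
    "1 - \<alpha> * \<beta> * X\<^sup>2 * q \<noteq> 0" "1 - \<alpha> * \<beta> * X\<^sup>2 * q\<^sup>2 \<noteq> 0"
  shows "0 =
     X * ((1 - X * q) * (1 - \<alpha> * X * q) * (1 - \<alpha> * \<beta> * X * q))
       / ((X * q - 1) * (1 - \<alpha> * \<beta> * X\<^sup>2 * q) * (1 - \<alpha> * \<beta> * X\<^sup>2 * q\<^sup>2))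
   + X * ((1 + \<alpha>) - \<alpha> * (1 + \<beta>) * (1 + q) * X + \<alpha> * \<beta> * q * (1 + \<alpha>) * X\<^sup>2)
       / ((1 - \<alpha> * \<beta> * X\<^sup>2) * (1 - \<alpha> * \<beta> * X\<^sup>2 * q\<^sup>2))
   + X * (\<alpha> * (1 - \<beta> * X) * (X - 1))
       / ((1 - \<alpha> * \<beta> * X\<^sup>2) * (1 - \<alpha> * \<beta> * X\<^sup>2 * q))"
proof -
  let ?B = "(1 - X * q) * (1 - \<alpha> * X * q) * (1 - \<alpha> * \<beta> * X * q)"
  let ?C = "(1 + \<alpha>) - \<alpha> * (1 + \<beta>) * (1 + q) * X + \<alpha> * \<beta> * q * (1 + \<alpha>) * X\<^sup>2"
  let ?F = "\<alpha> * (1 - \<beta> * X) * (X - 1)"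
  have "0 * (1 - \<alpha> * \<beta> * X\<^sup>2) * (1 - \<alpha> * \<beta> * X\<^sup>2 * q) * (1 - \<alpha> * \<beta> * X\<^sup>2 * q\<^sup>2) =
      ?B * 1 * (1 - \<alpha> * \<beta> * X\<^sup>2) + ?C * (X * q - 1) * 1 * (1 - \<alpha> * \<beta> * X\<^sup>2 * q)
      + ?F * (X * q - 1) * (1 - \<alpha> * \<beta> * X\<^sup>2 * q\<^sup>2)"
    by algebra
  \<comment> \<open>The cancelled factor is \<open>d1\<close> of the pattern, hence the 1 in its place.\<close>
  from common_denominator[OF this assms(1) one_neq_zero assms(2-4), of X] show ?thesis
    by (simp only: mult_zero_right div_0 mult_1_left)
qed

section \<open>Coefficients of the monic polynomials\<close>

locale little_q_jacobi_parameters =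
  fixes q \<alpha> \<beta> :: real
  assumes q_pos: "0 < q" and q_less_1: "q < 1"
    and \<alpha>_pos: "0 < \<alpha>" and \<alpha>_less: "\<alpha> < 1 / q"
    and \<beta>_less: "\<beta> < 1 / q"
begin

abbreviation p_coeff :: "nat \<Rightarrow> nat \<Rightarrow> real" where
  "p_coeff n k \<equiv> coeff (little_q_jacobi n \<alpha> \<beta> q) k"

abbreviation monic_coeff :: "nat \<Rightarrow> nat \<Rightarrow> real" where
  "monic_coeff n k \<equiv> coeff (monic_little_q_jacobi n \<alpha> \<beta> q) k"

lemma q_power_less_1: "0 < j \<Longrightarrow> q ^ j < 1"
  using q_pos q_less_1 by (simp add: power_Suc_less_one power_less_one_iff)

lemma q_power_decreasing: "k < n \<Longrightarrow> q ^ n < q ^ k"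
  using q_pos q_less_1 by (simp add: power_strict_decreasing)

lemma \<alpha>_power_less_1: "0 < j \<Longrightarrow> \<alpha> * q ^ j < 1"
proof -
  assume "0 < j"
  then have "q ^ j \<le> q ^ 1" using q_pos q_less_1 by (intro power_decreasing) auto
  then have "\<alpha> * q ^ j \<le> \<alpha> * q" using \<alpha>_pos by simp
  also have "\<dots> < 1" using \<alpha>_less q_pos by (simp add: field_simps)
  finally show ?thesis .
qed

text \<open>
  The exponent 2 is sharp: for positive \<open>\<beta>\<close> the bound is the product of \<open>\<alpha> * q < 1\<close> and
  \<open>\<beta> * q < 1\<close>, while \<open>\<alpha> * \<beta> * q = 1\<close> and \<open>\<alpha> * \<beta> = 1\<close> do occur.
\<close>

lemma \<alpha>\<beta>_power_less_1:
  assumes "2 \<le> j" shows "\<alpha> * \<beta> * q ^ j < 1"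
proof (cases "\<beta> \<le> 0")
  case True
  then have "\<alpha> * \<beta> * q ^ j \<le> 0"
    using \<alpha>_pos q_pos by (simp add: mult_nonneg_nonpos mult_nonpos_nonneg)
  then show ?thesis by simp
next
  case False
  have "q ^ j \<le> q ^ 2" using assms q_pos q_less_1 by (intro power_decreasing) auto
  then have "\<alpha> * \<beta> * q ^ j \<le> \<alpha> * \<beta> * q ^ 2" using \<alpha>_pos False by simp
  also have "\<dots> = (\<alpha> * q) * (\<beta> * q)" by (simp add: power2_eq_square)
  also have "\<dots> < 1 * 1"
    using \<alpha>_less \<beta>_less \<alpha>_pos q_pos False by (intro mult_strict_mono) (auto simp: field_simps)
  finally show ?thesis by simp
qed

lemma \<alpha>\<beta>_factors_nonzero:
  assumes "1 \<le> n"
  shows "1 - \<alpha> * \<beta> * (q ^ n)\<^sup>2 \<noteq> 0" "1 - \<alpha> * \<beta> * (q ^ n)\<^sup>2 * q \<noteq> 0"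
    "1 - \<alpha> * \<beta> * (q ^ n)\<^sup>2 * q\<^sup>2 \<noteq> 0"
  using \<alpha>\<beta>_power_less_1[of "2 * n"] \<alpha>\<beta>_power_less_1[of "2 * n + 1"] \<alpha>\<beta>_power_less_1[of "2 * n + 2"] assms
  unfolding power_add power_even_eq by (simp_all add: mult.assoc)

lemma coeff_little_q_jacobi:
  "p_coeff n k =
     (if k \<le> n then q_pochhammer (q powi (- int n)) q k * q_pochhammer (\<alpha> * \<beta> * q ^ (n + 1)) q k
                     / (q_pochhammer q q k * q_pochhammer (\<alpha> * q) q k) * q ^ k else 0)"
proof -
  have "[:0, q:] ^ j = monom (q ^ j) j" for j
  proof -
    have "[:0, q:] = monom q 1" by (simp add: monom_Suc monom_0)
    then show ?thesis by (simp only: monom_power mult_1_left)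
  qed
  then show ?thesis
    by (simp add: little_q_jacobi_def coeff_sum smult_monom)
qed

text \<open>
  Stated without negative powers of \<open>q\<close>: the factor \<open>1 - q ^ (k - n)\<close> is written as
  \<open>(q ^ n - q ^ k) / q ^ n\<close>.
\<close>

lemma p_coeff_Suc:
  assumes "k < n"
  shows "p_coeff n (Suc k) = p_coeff n k *
    ((q ^ n - q ^ k) * (1 - \<alpha> * \<beta> * q ^ (n + k + 1)) * q
      / (q ^ n * (1 - q ^ (k + 1)) * (1 - \<alpha> * q ^ (k + 1))))"
proof -
  have "1 - q powi (- int n) * q ^ k = (q ^ n - q ^ k) / q ^ n"
    using q_pos by (simp add: power_int_minus field_simps)
  then show ?thesis
    using assms by (simp add: coeff_little_q_jacobi q_pochhammer_def power_add mult_ac)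
qed

lemma p_coeff_nonzero: "k \<le> n \<Longrightarrow> p_coeff n k \<noteq> 0"
proof (induction k)
  case 0
  show ?case by (simp add: coeff_little_q_jacobi q_pochhammer_def)
next
  case (Suc k)
  then have "p_coeff n k \<noteq> 0" by simp
  moreover have "q ^ n - q ^ k \<noteq> 0" using q_power_decreasing[of k n] Suc by simp
  moreover have "1 - \<alpha> * \<beta> * q ^ (n + k + 1) \<noteq> 0" using \<alpha>\<beta>_power_less_1[of "n + k + 1"] Suc by simp
  moreover have "1 - q ^ (k + 1) \<noteq> 0" using q_power_less_1[of "k + 1"] by simp
  moreover have "1 - \<alpha> * q ^ (k + 1) \<noteq> 0" using \<alpha>_power_less_1[of "k + 1"] by simp
  moreover have "k < n" using Suc by simp
  ultimately show ?case using q_pos unfolding p_coeff_Suc[OF \<open>k < n\<close>] by simp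
qed

lemma degree_little_q_jacobi: "degree (little_q_jacobi n \<alpha> \<beta> q) = n"
proof (rule antisym)
  show "degree (little_q_jacobi n \<alpha> \<beta> q) \<le> n"
    by (rule degree_le) (simp add: coeff_little_q_jacobi)
  show "n \<le> degree (little_q_jacobi n \<alpha> \<beta> q)"
    by (rule le_degree) (simp add: p_coeff_nonzero)
qed

lemma monic_coeff: "monic_coeff n k = p_coeff n k / p_coeff n n"
  by (simp add: monic_little_q_jacobi_def degree_little_q_jacobi)

lemma monic_coeff_self: "monic_coeff n n = 1"
  by (simp add: monic_coeff p_coeff_nonzero)

lemma monic_coeff_above: "n < k \<Longrightarrow> monic_coeff n k = 0"
  by (simp add: monic_coeff coeff_little_q_jacobi)

lemma monic_coeff_step:
  assumes "k < n"
  shows "monic_coeff n k = monic_coeff n (Suc k) *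
    (q ^ n * ((1 - q ^ (k + 1)) * (1 - \<alpha> * q ^ (k + 1)))
      / ((q ^ n - q ^ k) * (1 - \<alpha> * \<beta> * q ^ (n + k + 1)) * q))"
proof -
  have "q ^ n - q ^ k \<noteq> 0" using q_power_decreasing[OF assms] by simp
  moreover have "1 - \<alpha> * \<beta> * q ^ (n + k + 1) \<noteq> 0" using \<alpha>\<beta>_power_less_1[of "n + k + 1"] assms by simp
  moreover have "1 - q ^ (k + 1) \<noteq> 0" using q_power_less_1[of "k + 1"] by simp
  moreover have "1 - \<alpha> * q ^ (k + 1) \<noteq> 0" using \<alpha>_power_less_1[of "k + 1"] by simp
  ultimately show ?thesis
    using q_pos unfolding monic_coeff p_coeff_Suc[OF assms] by simp
qed

text \<open>
  At \<open>k = n\<close> this is \<open>monic_coeff_step\<close> for degree \<open>n + 1\<close>, and lowering \<open>k\<close> multiplies both sides by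
  known ratios, so the rule follows by descending induction.  For \<open>n = 0\<close> the factor
  \<open>1 - \<alpha> * \<beta> * q\<close> may vanish in numerator and denominator, and the formula would fail.
\<close>

lemma monic_coeff_degree_step:
  assumes "1 \<le> n" "k \<le> n"
  shows "monic_coeff (Suc n) k = monic_coeff n k *
    (q ^ n * ((1 - q ^ n * q) * (1 - \<alpha> * q ^ n * q) * (1 - \<alpha> * \<beta> * q ^ n * q ^ k * q))
      / ((q ^ n * q - q ^ k) * (1 - \<alpha> * \<beta> * (q ^ n)\<^sup>2 * q) * (1 - \<alpha> * \<beta> * (q ^ n)\<^sup>2 * q\<^sup>2)))"
  using assms(2)
proof (induction rule: inc_induct)
  case base
  have "q ^ n * q - q ^ n \<noteq> 0" using q_pos q_less_1 by simp
  moreover have "q ^ (Suc n + n + 1) = (q ^ n)\<^sup>2 * q\<^sup>2"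
    by (simp add: power_add power2_eq_square mult_ac)
  moreover have sq: "\<alpha> * \<beta> * q ^ n * q ^ n * q = \<alpha> * \<beta> * (q ^ n)\<^sup>2 * q"
    by (simp add: power2_eq_square)
  ultimately show ?case
    using monic_coeff_step[of n "Suc n"] \<alpha>\<beta>_factors_nonzero[OF assms(1)] q_pos
    unfolding sq by (simp add: monic_coeff_self mult_ac)
next
  case (step k)
  let ?R = "\<lambda>k. q ^ n * ((1 - q ^ n * q) * (1 - \<alpha> * q ^ n * q) * (1 - \<alpha> * \<beta> * q ^ n * q ^ k * q))
      / ((q ^ n * q - q ^ k) * (1 - \<alpha> * \<beta> * (q ^ n)\<^sup>2 * q) * (1 - \<alpha> * \<beta> * (q ^ n)\<^sup>2 * q\<^sup>2))"
  let ?r = "\<lambda>n. q ^ n * ((1 - q ^ (k + 1)) * (1 - \<alpha> * q ^ (k + 1)))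
      / ((q ^ n - q ^ k) * (1 - \<alpha> * \<beta> * q ^ (n + k + 1)) * q)"
  have nz: "q ^ n - q ^ k \<noteq> 0" "q ^ n * q - q ^ k \<noteq> 0" "q ^ n * q - q ^ k * q \<noteq> 0"
    using q_power_decreasing[of k n] q_power_decreasing[of k "Suc n"] step.hyps q_pos
    by (auto simp: mult.commute)
  have nz': "1 - \<alpha> * \<beta> * q ^ n * q ^ k * q \<noteq> 0" "1 - \<alpha> * \<beta> * q ^ n * q ^ k * q * q \<noteq> 0"
    using \<alpha>\<beta>_power_less_1[of "n + k + 1"] \<alpha>\<beta>_power_less_1[of "n + k + 2"] assms
    by (auto simp: power_add mult_ac power2_eq_square)
  have diff: "q ^ n * q - q ^ Suc k = (q ^ n - q ^ k) * q" by (simp add: algebra_simps)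
  have cancel: "?R (Suc k) * ?r (Suc n) = ?r n * ?R k"
    unfolding diff using nz nz' q_pos by (simp add: power_add power2_eq_square) (simp add: mult_ac)
  have "monic_coeff (Suc n) k = monic_coeff (Suc n) (Suc k) * ?r (Suc n)"
    using monic_coeff_step[of k "Suc n"] step.hyps by simp
  also have "\<dots> = monic_coeff n (Suc k) * (?R (Suc k) * ?r (Suc n))"
    using step.IH by simp
  also have "\<dots> = monic_coeff n (Suc k) * ?r n * ?R k"
    unfolding cancel by simp
  also have "monic_coeff n (Suc k) * ?r n = monic_coeff n k"
    using monic_coeff_step[of k n] step.hyps by simp
  finally show ?case .
qed

section \<open>The recurrence coefficients\<close>

lemma rec_b_0: "rec_b 0 \<alpha> \<beta> q = (1 - \<alpha> * q) / (1 - \<alpha> * \<beta> * q\<^sup>2)"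
proof -
  define h where "h = (\<lambda>(a, b). (1 - a * q) / (1 - a * b * q\<^sup>2))"
  have nz: "1 - \<alpha> * \<beta> * q\<^sup>2 \<noteq> 0" using \<alpha>\<beta>_power_less_1[of 2] by simp
  have "rec_b 0 \<alpha> \<beta> q = h (\<alpha>, \<beta>)"
    unfolding rec_b_def
  proof (rule quotient_by_continuity_eq, goal_cases)
    case 1
    show ?case unfolding h_def case_prod_beta using nz by (intro continuous_intros) auto
  next
    case (2 w)
    obtain a b where w: "w = (a, b)" by force
    \<comment> \<open>The numerator contains the critical factor of the denominator.\<close>
    have "(1 + a) - a * (1 + b) * (1 + q) + a * b * q * (1 + a) = (1 - a * b) * (1 - a * q)"
      by algebra
    then show ?case using 2 by (simp add: w h_def power2_eq_square)
  next
    case 3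
    then have s: "\<alpha> * \<beta> = 1" using nz by (simp add: power2_eq_square)
    show ?case
    proof (rule islimpt_vertical_ray)
      show "\<beta> \<noteq> 0" using s by auto
      fix t :: real assume t: "0 < t" "t < 1"
      have st: "\<alpha> * (t * \<beta>) = t" using s by (simp add: mult.left_commute)
      have "t * q\<^sup>2 < 1 * 1" using t q_power_less_1[of 2] q_pos by (intro mult_strict_mono) auto
      then show "(\<alpha>, t * \<beta>) \<in> {w. (case w of (\<alpha>, \<beta>) \<Rightarrow>
            (1 - \<alpha> * \<beta> * q ^ (2 * 0)) * (1 - \<alpha> * \<beta> * q ^ (2 * 0 + 2))) \<noteq> 0}"
        unfolding mem_Collect_eq prod.case st using t by (simp add: power2_eq_square)
    qed
  qed
  then show ?thesis by (simp add: h_def)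
qed

lemma rec_b_ge_1:
  assumes "1 \<le> n"
  shows "rec_b n \<alpha> \<beta> q =
     q ^ n * ((1 + \<alpha>) - \<alpha> * (1 + \<beta>) * (1 + q) * q ^ n + \<alpha> * \<beta> * q * (1 + \<alpha>) * (q ^ n)\<^sup>2)
       / ((1 - \<alpha> * \<beta> * (q ^ n)\<^sup>2) * (1 - \<alpha> * \<beta> * (q ^ n)\<^sup>2 * q\<^sup>2))"
  unfolding rec_b_def quotient_by_continuity_def
  using \<alpha>\<beta>_factors_nonzero[OF assms] unfolding power_add power_even_eq by (simp add: mult.assoc)

lemma rec_c_1:
  "rec_c 1 \<alpha> \<beta> q = \<alpha> * q * (1 - q) * (1 - \<alpha> * q) * (1 - \<beta> * q)
     / ((1 - \<alpha> * \<beta> * q\<^sup>2)\<^sup>2 * (1 - \<alpha> * \<beta> * q ^ 3))"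
proof -
  define h where "h = (\<lambda>(a, b). a * q * (1 - q) * (1 - a * q) * (1 - b * q)
     / ((1 - a * b * q\<^sup>2)\<^sup>2 * (1 - a * b * q ^ 3)))"
  have nz: "1 - \<alpha> * \<beta> * q\<^sup>2 \<noteq> 0" "1 - \<alpha> * \<beta> * q ^ 3 \<noteq> 0"
    using \<alpha>\<beta>_power_less_1[of 2] \<alpha>\<beta>_power_less_1[of 3] by auto
  have "rec_c 1 \<alpha> \<beta> q = h (\<alpha>, \<beta>)"
    unfolding rec_c_def
  proof (rule quotient_by_continuity_eq, goal_cases)
    case 1
    show ?case unfolding h_def case_prod_beta using nz by (intro continuous_intros) auto
  next
    case (2 w)
    obtain a b where w: "w = (a, b)" by force
    show ?case using 2 by (simp add: w h_def)
  next
    case 3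
    then have s: "\<alpha> * \<beta> * q = 1" using nz by simp
    show ?case
    proof (rule islimpt_vertical_ray)
      show "\<beta> \<noteq> 0" using s by auto
      fix t :: real assume t: "0 < t" "t < 1"
      have st: "\<alpha> * (t * \<beta>) * q ^ Suc j = t * q ^ j" for j
        using arg_cong[OF s, of "\<lambda>u. u * (t * q ^ j)"] by (simp add: mult_ac)
      have "\<alpha> * (t * \<beta>) * q ^ Suc j \<noteq> 1" for j
      proof -
        have "t * q ^ j \<le> t * 1"
          using t q_pos q_less_1 by (intro mult_left_mono power_le_one) auto
        then show ?thesis unfolding st using t by linarith
      qed
      note nz = this[of 0] this[of 1] this[of 2]
      show "(\<alpha>, t * \<beta>) \<in> {w. (case w of (\<alpha>, \<beta>) \<Rightarrow>
            (1 - \<alpha> * \<beta> * q ^ (2 * 1 - 1)) * (1 - \<alpha> * \<beta> * q ^ (2 * 1))\<^sup>2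
              * (1 - \<alpha> * \<beta> * q ^ (2 * 1 + 1))) \<noteq> 0}"
        using nz by (simp add: numeral_eq_Suc)
    qed
  qed
  then show ?thesis by (simp add: h_def)
qed

lemma rec_c_ge_2:
  assumes "2 \<le> n"
  shows "rec_c n \<alpha> \<beta> q =
     \<alpha> * (q ^ n)\<^sup>2 / q * ((1 - q ^ n) * (1 - \<alpha> * q ^ n) * (1 - \<beta> * q ^ n) * (1 - \<alpha> * \<beta> * q ^ n))
       / ((1 - \<alpha> * \<beta> * ((q ^ n)\<^sup>2 / q)) * (1 - \<alpha> * \<beta> * (q ^ n)\<^sup>2)\<^sup>2 * (1 - \<alpha> * \<beta> * (q ^ n)\<^sup>2 * q))"
proof -
  have pw: "q ^ (2 * n - 1) = (q ^ n)\<^sup>2 / q" "q ^ (2 * n) = (q ^ n)\<^sup>2" "q ^ (2 * n + 1) = (q ^ n)\<^sup>2 * q"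
    using q_pos assms by (auto simp: power_diff power_even_eq)
  have "2 \<le> 2 * n - 1" using assms by simp
  note odd_factor = \<alpha>\<beta>_power_less_1[OF this]
  have nz: "1 - \<alpha> * \<beta> * q ^ (2 * n - 1) \<noteq> 0" "1 - \<alpha> * \<beta> * q ^ (2 * n) \<noteq> 0"
    "1 - \<alpha> * \<beta> * q ^ (2 * n + 1) \<noteq> 0"
    using \<alpha>\<beta>_factors_nonzero[of n] odd_factor assms unfolding pw(2,3) by auto
  show ?thesis
    unfolding rec_c_def quotient_by_continuity_def using nz unfolding pw by (simp add: mult.assoc)
qed

section \<open>The recurrence for the coefficients\<close>

text \<open>
  The last term of the recurrence as a multiple of \<open>monic_coeff n k\<close>.  For \<open>n \<ge> 2\<close> it comes from
  \<open>monic_coeff_degree_step\<close> at \<open>n - 1\<close>.  At \<open>k = 0\<close> the factor \<open>1 - \<alpha> * \<beta> * q ^ n\<close> appears in numerator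
  and denominator; dropping it by the conditionals covers \<open>n = 1\<close>, where it can vanish.
\<close>

lemma rec_c_monic_coeff:
  assumes "1 \<le> n" "k \<le> n"
  shows "rec_c n \<alpha> \<beta> q * monic_coeff (n - 1) k = monic_coeff n k *
     (q ^ n * (\<alpha> * (1 - \<beta> * q ^ n) * (if k = 0 then 1 else 1 - \<alpha> * \<beta> * q ^ n) * (q ^ n - q ^ k))
      / ((if k = 0 then 1 else 1 - \<alpha> * \<beta> * q ^ n * q ^ k)
          * (1 - \<alpha> * \<beta> * (q ^ n)\<^sup>2) * (1 - \<alpha> * \<beta> * (q ^ n)\<^sup>2 * q)))"
proof -
  consider "k = n" | "n = 1" "k = 0" | m where "n = Suc m" "1 \<le> m" "k \<le> m"
    using assms by (cases n) force+
  then show ?thesis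
  proof cases
    case 1
    \<comment> \<open>Both sides vanish, the right one because of its factor \<open>q ^ n - q ^ k\<close>.\<close>
    then show ?thesis using assms by (simp add: monic_coeff_above)
  next
    case 2
    have "1 - q \<noteq> 0" "q - 1 \<noteq> 0" using q_less_1 by auto
    moreover have "1 - \<alpha> * \<beta> * q\<^sup>2 \<noteq> 0" using \<alpha>\<beta>_power_less_1[of 2] by simp
    ultimately show ?thesis
      using q_pos monic_coeff_step[of 0 1] monic_coeff_self[of 0] monic_coeff_self[of 1]
      unfolding 2 rec_c_1
      by (simp add: divide_simps numeral_eq_Suc) algebra
  next
    case 3
    define X Y where "X = q ^ n" and "Y = q ^ k"
    have Z: "q ^ m = X / q" using q_pos by (simp add: X_def 3)
    have "X < Y" unfolding X_def Y_def using q_power_decreasing[of k n] 3 by simp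
    then have nz1: "X - Y \<noteq> 0" by simp
    have nz2: "1 - X \<noteq> 0" "1 - \<alpha> * X \<noteq> 0"
      unfolding X_def using q_power_less_1[of n] \<alpha>_power_less_1[of n] assms by auto
    have nz3: "1 - \<alpha> * \<beta> * X * Y \<noteq> 0" "1 - \<alpha> * \<beta> * X \<noteq> 0"
      "1 - \<alpha> * \<beta> * (X\<^sup>2 / q) \<noteq> 0" "1 - \<alpha> * \<beta> * X\<^sup>2 \<noteq> 0"
      using \<alpha>\<beta>_power_less_1[of "n + k"] \<alpha>\<beta>_power_less_1[of n] \<alpha>\<beta>_power_less_1[of "n + m"]
        \<alpha>\<beta>_power_less_1[of "n + n"] 3 q_pos
      by (auto simp: X_def Y_def power_add power2_eq_square mult_ac)
    have R: "monic_coeff n k = monic_coeff m k *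
      (X / q * ((1 - X) * (1 - \<alpha> * X) * (1 - \<alpha> * \<beta> * X * Y))
      / ((X - Y) * (1 - \<alpha> * \<beta> * (X\<^sup>2 / q)) * (1 - \<alpha> * \<beta> * X\<^sup>2)))"
      using monic_coeff_degree_step[OF 3(2,3)] q_pos
      unfolding Z Y_def[symmetric] 3(1)[symmetric] by (simp add: power2_eq_square)
    have C: "rec_c n \<alpha> \<beta> q =
      \<alpha> * X\<^sup>2 / q * ((1 - X) * (1 - \<alpha> * X) * (1 - \<beta> * X) * (1 - \<alpha> * \<beta> * X))
       / ((1 - \<alpha> * \<beta> * (X\<^sup>2 / q)) * (1 - \<alpha> * \<beta> * X\<^sup>2)\<^sup>2 * (1 - \<alpha> * \<beta> * X\<^sup>2 * q))"
      unfolding X_def using 3 by (intro rec_c_ge_2) simp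
    \<comment> \<open>The factors are generalised to variables, so that simplification only cancels them.\<close>
    have cancel: "\<alpha> * X\<^sup>2 / q * (a * b * B * S) / (w * d\<^sup>2 * f) * M =
        M * (X / q * (a * b * u) / (e * w * d)) * (X * (\<alpha> * B * S * e) / (u * d * f))"
      if "a \<noteq> 0" "b \<noteq> 0" "w \<noteq> 0" "d \<noteq> 0" "u \<noteq> 0" "e \<noteq> 0" "q \<noteq> 0" for a b B S w d f u e M
      using that by (simp add: power2_eq_square mult_ac)
    have "rec_c n \<alpha> \<beta> q * monic_coeff m k = monic_coeff n k *
     (X * (\<alpha> * (1 - \<beta> * X) * (1 - \<alpha> * \<beta> * X) * (X - Y))
      / ((1 - \<alpha> * \<beta> * X * Y) * (1 - \<alpha> * \<beta> * X\<^sup>2) * (1 - \<alpha> * \<beta> * X\<^sup>2 * q)))"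
      unfolding R C by (rule cancel) (use nz1 nz2 nz3 q_pos in auto)
    moreover have "Y = 1" if "k = 0" using that by (simp add: Y_def)
    ultimately show ?thesis
      unfolding X_def[symmetric] Y_def[symmetric] using nz3 3(1) by simp
  qed
qed

lemma monic_coeff_recurrence_ge_1:
  assumes "1 \<le> n"
  shows "(if k = 0 then 0 else monic_coeff n (k - 1)) =
    monic_coeff (Suc n) k + rec_b n \<alpha> \<beta> q * monic_coeff n k + rec_c n \<alpha> \<beta> q * monic_coeff (n - 1) k"
proof -
  consider "k \<le> n" | "k = Suc n" | "Suc n < k" by linarith
  then show ?thesis
  proof cases
    case 1
    define X Y where "X = q ^ n" and "Y = q ^ k"
    have "X * q < Y"
      unfolding X_def Y_def using q_power_decreasing[of k "Suc n"] 1 by (simp add: mult.commute)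
    then have nz: "X * q - Y \<noteq> 0" "1 - \<alpha> * \<beta> * X\<^sup>2 \<noteq> 0"
      "1 - \<alpha> * \<beta> * X\<^sup>2 * q \<noteq> 0" "1 - \<alpha> * \<beta> * X\<^sup>2 * q\<^sup>2 \<noteq> 0"
      unfolding X_def using \<alpha>\<beta>_factors_nonzero[OF assms] by simp_all
    have combine: "u * z = u * a + b * u + u * c" if "z = a + b + c" for u z a b c :: real
      using that by (simp add: algebra_simps)
    note steps = rec_c_monic_coeff[OF assms 1] monic_coeff_degree_step[OF assms 1] rec_b_ge_1[OF assms]
    show ?thesis
    proof (cases "k = 0")
      case True
      have "monic_coeff n k * 0 =
          monic_coeff (Suc n) k + rec_b n \<alpha> \<beta> q * monic_coeff n k + rec_c n \<alpha> \<beta> q * monic_coeff (n - 1) k"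
        unfolding steps X_def[symmetric] unfolding True power_0 if_P[OF refl] mult_1_left mult_1_right
        by (rule combine[OF constant_coefficient_identity[OF nz(1)[unfolded Y_def True power_0] nz(2-4)]])
      then show ?thesis using True by simp
    next
      case False
      then obtain j where j: "k = Suc j" by (cases k) auto
      have Y: "q ^ j = Y / q" using q_pos by (simp add: Y_def j)
      have nz': "1 - \<alpha> * \<beta> * X * Y \<noteq> 0"
        using \<alpha>\<beta>_power_less_1[of "n + k"] assms j by (simp add: X_def Y_def power_add mult_ac)
      have "monic_coeff n j = monic_coeff n k * (X * ((1 - Y) * (1 - \<alpha> * Y)) / ((X - Y / q) * (1 - \<alpha> * \<beta> * X * Y) * q))"
        using monic_coeff_step[of j n] 1 j
        by (simp add: X_def Y_def power_add mult_ac flip: Y)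
      also have "(X - Y / q) * (1 - \<alpha> * \<beta> * X * Y) * q = (X * q - Y) * (1 - \<alpha> * \<beta> * X * Y)"
        using q_pos by (simp add: field_simps)
      finally have "monic_coeff n j = monic_coeff n k * (X * ((1 - Y) * (1 - \<alpha> * Y)) / ((X * q - Y) * (1 - \<alpha> * \<beta> * X * Y)))" .
      also have "\<dots> =
          monic_coeff (Suc n) k + rec_b n \<alpha> \<beta> q * monic_coeff n k + rec_c n \<alpha> \<beta> q * monic_coeff (n - 1) k"
        unfolding steps X_def[symmetric] Y_def[symmetric] if_not_P[OF False]
        by (rule combine[OF coefficient_identity[OF nz(1) nz' nz(2-4)]])
      finally show ?thesis using j by simp
    qed
  next
    case 2
    then show ?thesis using assms by (simp add: monic_coeff_self monic_coeff_above)
  next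
    case 3
    then show ?thesis by (simp add: monic_coeff_above)
  qed
qed

lemma monic_coeff_recurrence_0:
  "(if k = 0 then 0 else monic_coeff 0 (k - 1)) =
    monic_coeff 1 k + rec_b 0 \<alpha> \<beta> q * monic_coeff 0 k"
proof -
  consider "k = 0" | "k = 1" | "1 < k" by linarith
  then show ?thesis
  proof cases
    case 1
    have "(1 - q) / (q - 1) = - 1" using q_less_1 by (simp add: field_simps)
    then have sign: "(1 - q) * c / ((q - 1) * d) = - (c / d)" for c d
      by (simp flip: times_divide_times_eq)
    have "monic_coeff 1 0 = - ((1 - \<alpha> * q) / (1 - \<alpha> * \<beta> * q\<^sup>2))"
      using monic_coeff_step[of 0 1] monic_coeff_self[of 1] q_pos
      by (simp add: power2_eq_square sign)
    then show ?thesis by (simp add: 1 rec_b_0 monic_coeff_self)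
  next
    case 2
    then show ?thesis using monic_coeff_self[of 0] monic_coeff_self[of 1]
      by (simp add: monic_coeff_above)
  next
    case 3
    then show ?thesis by (simp add: monic_coeff_above)
  qed
qed

end

theorem proposition4p7:
  fixes q \<alpha> \<beta> :: real and n :: nat
  assumes "0 < q" "q < 1"
    and "0 < \<alpha>" "\<alpha> < 1 / q"
    and "\<beta> < 1 / q"
  shows "[:0, 1:] * monic_little_q_jacobi n \<alpha> \<beta> q =
           monic_little_q_jacobi (n + 1) \<alpha> \<beta> q
           + smult (rec_b n \<alpha> \<beta> q) (monic_little_q_jacobi n \<alpha> \<beta> q)
           + (if n = 0 then 0
              else smult (rec_c n \<alpha> \<beta> q) (monic_little_q_jacobi (n - 1) \<alpha> \<beta> q))"
proof (rule poly_eqI)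
  fix k
  interpret little_q_jacobi_parameters q \<alpha> \<beta> using assms by unfold_locales
  have "coeff ([:0, 1:] * monic_little_q_jacobi n \<alpha> \<beta> q) k = (if k = 0 then 0 else monic_coeff n (k - 1))"
    by (cases k) simp_all
  then show "coeff ([:0, 1:] * monic_little_q_jacobi n \<alpha> \<beta> q) k =
      coeff (monic_little_q_jacobi (n + 1) \<alpha> \<beta> q
           + smult (rec_b n \<alpha> \<beta> q) (monic_little_q_jacobi n \<alpha> \<beta> q)
           + (if n = 0 then 0
              else smult (rec_c n \<alpha> \<beta> q) (monic_little_q_jacobi (n - 1) \<alpha> \<beta> q))) k"
    using monic_coeff_recurrence_0[of k] monic_coeff_recurrence_ge_1[of n k] by (cases "n = 0"; cases "k = 0") simp_all
qed

end
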